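(* If $n$ is a positive integer, then $\mathbb{SL}^n$ is star-shaped at $e$.
   Context: A real $n\times n$ matrix $A$ is stochastic if all its entries are nonnegative and every row sums to $1$. For $x\in\mathbb{C}^n$, $\Lambda(x)$ denotes the list (multiset) $\{x_1,\dots,x_n\}$, and $\operatorname{spec}(A)$ denotes the multiset of eigenvalues of $A$ (with algebraic multiplicity). Define $$\mathbb{SL}^n := \{x\in\mathbb{C}^n \mid \Lambda(x)=\operatorname{spec}(A) \text{ for some stochastic } A\in \mathsf{M}_n(\mathbb{R})\}.$$ The vector $e\in\mathbb{C}^n$ is the all-ones vector. A set $K\subseteq\mathbb{C}^n$ is star-shaped at $c\in K$ if for every $x\in K$ the segment $\{\alpha x+(1-\alpha)c \mid \alpha\in[0,1]\}$ is contained in $K$. *)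

theory Defs
  imports "Jordan_Normal_Form.Spectral_Radius"
begin

definition stochastic_mat :: "nat \<Rightarrow> real mat \<Rightarrow> bool" where
  "stochastic_mat n A \<longleftrightarrow> A \<in> carrier_mat n n \<and>
     (\<forall>i<n. \<forall>j<n. A $$ (i, j) \<ge> 0) \<and> (\<forall>i<n. (\<Sum>j<n. A $$ (i, j)) = 1)"

definition Lambda_mset :: "complex vec \<Rightarrow> complex multiset" where
  "Lambda_mset x = mset (list_of_vec x)"

(* Algebraic multiplicity is multiplicity as a root of the characteristic polynomial,
   which is how proots counts. *)
definition spec_mset :: "complex mat \<Rightarrow> complex multiset" where
  "spec_mset A = proots (char_poly A)"

lemma set_mset_spec_mset:
  assumes "A \<in> carrier_mat n n"
  shows "set_mset (spec_mset A) = spectrum A"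
proof -
  have "char_poly A \<noteq> 0"
    using degree_monic_char_poly[OF assms] by auto
  then show ?thesis
    by (simp add: spec_mset_def spectrum_root_char_poly[OF assms])
qed

(* The eigenvalues of the real matrix A are taken over the complex numbers. *)
definition SL :: "nat \<Rightarrow> complex vec set" where
  "SL n = {x \<in> carrier_vec n. \<exists>A. stochastic_mat n A \<and>
     Lambda_mset x = spec_mset (map_mat complex_of_real A)}"

definition ones_vec :: "nat \<Rightarrow> complex vec" where
  "ones_vec n = vec n (\<lambda>_. 1)"

(* Unlike the library's starlike, the centre is given. The type complex vec contains vectors of
   every dimension and is not a real vector space, so the segment is written out with
   complex_of_real scalars instead of closed_segment. *)
definition star_shaped_at :: "nat \<Rightarrow> complex vec set \<Rightarrow> complex vec \<Rightarrow> bool" where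
  "star_shaped_at n K c \<longleftrightarrow> K \<subseteq> carrier_vec n \<and> c \<in> K \<and>
     (\<forall>x\<in>K. {complex_of_real \<alpha> \<cdot>\<^sub>v x + complex_of_real (1 - \<alpha>) \<cdot>\<^sub>v c | \<alpha>. \<alpha> \<in> {0..1}} \<subseteq> K)"

end

theory Submission
  imports Defs
begin

text \<open>
  The segment from \<open>e\<close> to \<open>x\<close> is realised by the segment from the identity matrix to \<open>A\<close>.
  If \<open>A\<close> is a stochastic matrix with spectrum \<open>\<Lambda>(x)\<close>, then \<open>\<alpha> A + (1 - \<alpha>) I\<close>
  is again stochastic, because the identity is stochastic and stochastic matrices form a convex
  set (lemma \<open>stochastic_mat_convex\<close>). Its spectrum, counted with algebraic multiplicity, is
  the image of that of \<open>A\<close> under \<open>z \<mapsto> \<alpha> z + (1 - \<alpha>)\<close> (lemma \<open>spec_mset_affine\<close>), which is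
  exactly the list of entries of \<open>\<alpha> x + (1 - \<alpha>) e\<close>.

  Multiplicities are what makes the spectral mapping step more than a remark about eigenvectors.
  They are handled by triangularising: conjugation commutes with \<open>z \<mapsto> c z + d\<close> applied to
  matrices, and for a triangular matrix both spectra can be read off the diagonal.
\<close>

lemma spec_mset_upper_triangular:
  assumes "B \<in> carrier_mat n n" "upper_triangular B"
  shows "spec_mset B = mset (diag_mat B)"
proof -
  have "proots (\<Prod>a\<leftarrow>as. [:- a, 1:]) = mset as" for as :: "complex list"
  proof (induction as)
    case (Cons a as)
    have "(\<Prod>a\<leftarrow>as. [:- a, 1:]) \<noteq> 0"
      by (auto simp: prod_list_zero_iff)
    then show ?case
      using Cons by (simp add: proots_mult del: mult_pCons_left)
  qed simp
  then show ?thesis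
    by (simp add: spec_mset_def char_poly_upper_triangular[OF assms])
qed

lemma similar_mat_affine:
  fixes A B :: "'a :: comm_ring_1 mat"
  assumes A: "A \<in> carrier_mat n n" and "similar_mat A B"
  shows "similar_mat (c \<cdot>\<^sub>m A + d \<cdot>\<^sub>m 1\<^sub>m n) (c \<cdot>\<^sub>m B + d \<cdot>\<^sub>m 1\<^sub>m n)"
proof -
  from \<open>similar_mat A B\<close> obtain P Q where "similar_mat_wit A B P Q"
    unfolding similar_mat_def by blast
  from similar_mat_witD2[OF A this]
  have PQ: "P * Q = 1\<^sub>m n" "Q * P = 1\<^sub>m n" and eq: "A = P * B * Q"
    and B: "B \<in> carrier_mat n n" and P: "P \<in> carrier_mat n n" and Q: "Q \<in> carrier_mat n n"
    by auto
  have "P * (c \<cdot>\<^sub>m B + d \<cdot>\<^sub>m 1\<^sub>m n) * Q = (c \<cdot>\<^sub>m (P * B) + d \<cdot>\<^sub>m P) * Q"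
    using B P by (simp add: mult_add_distrib_mat[of _ n n _ n] mult_smult_distrib[of _ n n _ n])
  also have "\<dots> = c \<cdot>\<^sub>m (P * B * Q) + d \<cdot>\<^sub>m (P * Q)"
    using B P Q by (simp add: add_mult_distrib_mat[of _ n n _ _ n] mult_smult_assoc_mat[of _ n n _ n])
  finally have "c \<cdot>\<^sub>m A + d \<cdot>\<^sub>m 1\<^sub>m n = P * (c \<cdot>\<^sub>m B + d \<cdot>\<^sub>m 1\<^sub>m n) * Q"
    by (simp add: eq PQ)
  then show ?thesis
    using A B P Q PQ by (intro similar_matI) auto
qed

text \<open>
  Over the complex numbers the characteristic polynomial splits, so Schur's theorem makes \<open>A\<close>
  similar to a triangular matrix \<open>B\<close>. Then \<open>c A + d I\<close> is similar to the triangular matrix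
  \<open>c B + d I\<close>, whose diagonal is the entrywise image of that of \<open>B\<close>.
\<close>

lemma spec_mset_affine:
  assumes A: "A \<in> carrier_mat n n"
  shows "spec_mset (c \<cdot>\<^sub>m A + d \<cdot>\<^sub>m 1\<^sub>m n) = image_mset (\<lambda>z. c * z + d) (spec_mset A)"
proof -
  obtain es where "char_poly A = (\<Prod>a\<leftarrow>es. [:- a, 1:])"
    using char_poly_factorized[OF A] by blast
  from schur_upper_triangular[OF A this] obtain B where B: "B \<in> carrier_mat n n"
    and tri: "upper_triangular B" and sim: "similar_mat A B"
    by blast
  let ?B' = "c \<cdot>\<^sub>m B + d \<cdot>\<^sub>m 1\<^sub>m n"
  have B': "?B' \<in> carrier_mat n n"
    using B by simp
  have tri': "upper_triangular ?B'"
    using B upper_triangularD[OF tri] by (intro upper_triangularI) auto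
  have "diag_mat ?B' = map (\<lambda>z. c * z + d) (diag_mat B)"
    using B by (auto simp: diag_mat_def)
  moreover have "spec_mset (c \<cdot>\<^sub>m A + d \<cdot>\<^sub>m 1\<^sub>m n) = mset (diag_mat ?B')"
    unfolding spec_mset_upper_triangular[OF B' tri', symmetric] spec_mset_def
    using char_poly_similar[OF similar_mat_affine[OF A sim]] by simp
  moreover have "spec_mset A = mset (diag_mat B)"
    unfolding spec_mset_upper_triangular[OF B tri, symmetric] spec_mset_def
    using char_poly_similar[OF sim] by simp
  ultimately show ?thesis
    by simp
qed

lemma stochastic_mat_one: "stochastic_mat n (1\<^sub>m n)"
  by (auto simp: stochastic_mat_def)

lemma stochastic_mat_convex:
  assumes A: "stochastic_mat n A" and B: "stochastic_mat n B" and \<alpha>: "\<alpha> \<in> {0..1}"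
  shows "stochastic_mat n (\<alpha> \<cdot>\<^sub>m A + (1 - \<alpha>) \<cdot>\<^sub>m B)" (is "stochastic_mat n ?M")
proof -
  have carrier: "A \<in> carrier_mat n n" "B \<in> carrier_mat n n"
    using A B by (auto simp: stochastic_mat_def)
  have entry: "?M $$ (i, j) = \<alpha> * A $$ (i, j) + (1 - \<alpha>) * B $$ (i, j)" if "i < n" "j < n" for i j
    using that carrier by simp
  have "(\<Sum>j<n. ?M $$ (i, j)) = 1" if "i < n" for i
  proof -
    have "(\<Sum>j<n. ?M $$ (i, j)) = \<alpha> * (\<Sum>j<n. A $$ (i, j)) + (1 - \<alpha>) * (\<Sum>j<n. B $$ (i, j))"
      using that by (simp add: entry sum.distrib sum_distrib_left del: index_add_mat index_smult_mat)
    also have "\<dots> = 1"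
      using that A B by (simp add: stochastic_mat_def)
    finally show ?thesis .
  qed
  moreover have "?M $$ (i, j) \<ge> 0" if "i < n" "j < n" for i j
    unfolding entry[OF that] using that A B \<alpha> by (auto simp: stochastic_mat_def)
  ultimately show ?thesis
    using carrier by (auto simp: stochastic_mat_def simp del: index_add_mat index_smult_mat)
qed

lemma ones_vec_in_SL: "ones_vec n \<in> SL n"
proof -
  have "map_mat complex_of_real (1\<^sub>m n) = 1\<^sub>m n"
    by auto
  moreover have "list_of_vec (ones_vec n) = diag_mat (1\<^sub>m n)"
    by (simp add: ones_vec_def diag_mat_def)
  then have "Lambda_mset (ones_vec n) = spec_mset (1\<^sub>m n)"
    by (simp add: Lambda_mset_def
        spec_mset_upper_triangular[OF one_carrier_mat upper_triangular_one])
  ultimately show ?thesis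
    using stochastic_mat_one[of n] by (auto simp: SL_def ones_vec_def intro!: exI[of _ "1\<^sub>m n"])
qed

lemma SL_segment:
  assumes x: "x \<in> SL n" and \<alpha>: "\<alpha> \<in> {0..1}"
  shows "complex_of_real \<alpha> \<cdot>\<^sub>v x + complex_of_real (1 - \<alpha>) \<cdot>\<^sub>v ones_vec n \<in> SL n"
    (is "?y \<in> _")
proof -
  obtain A where dim: "x \<in> carrier_vec n" and A: "stochastic_mat n A"
    and spec: "Lambda_mset x = spec_mset (map_mat complex_of_real A)"
    using x by (auto simp: SL_def)
  let ?M = "\<alpha> \<cdot>\<^sub>m A + (1 - \<alpha>) \<cdot>\<^sub>m 1\<^sub>m n"
  let ?f = "\<lambda>z. complex_of_real \<alpha> * z + complex_of_real (1 - \<alpha>)"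
  have carrier: "A \<in> carrier_mat n n"
    using A by (simp add: stochastic_mat_def)
  have "list_of_vec ?y = map ?f (list_of_vec x)"
    using dim by (auto simp: ones_vec_def list_of_vec_map)
  then have "Lambda_mset ?y = image_mset ?f (Lambda_mset x)"
    by (simp add: Lambda_mset_def)
  also have "\<dots> = spec_mset (complex_of_real \<alpha> \<cdot>\<^sub>m map_mat complex_of_real A
      + complex_of_real (1 - \<alpha>) \<cdot>\<^sub>m 1\<^sub>m n)"
    using carrier by (simp add: spec spec_mset_affine)
  also have "complex_of_real \<alpha> \<cdot>\<^sub>m map_mat complex_of_real A
      + complex_of_real (1 - \<alpha>) \<cdot>\<^sub>m 1\<^sub>m n = map_mat complex_of_real ?M"
    using carrier by (intro eq_matI) auto
  finally have "Lambda_mset ?y = spec_mset (map_mat complex_of_real ?M)" .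
  moreover have "?y \<in> carrier_vec n"
    using dim by (simp add: ones_vec_def)
  ultimately show ?thesis
    using stochastic_mat_convex[OF A stochastic_mat_one \<alpha>] by (auto simp: SL_def)
qed

theorem theorem3p10:
  fixes n :: nat
  assumes "n > 0"
  shows "star_shaped_at n (SL n) (ones_vec n)"
proof -
  have "SL n \<subseteq> carrier_vec n"
    by (auto simp: SL_def)
  then show ?thesis
    unfolding star_shaped_at_def using ones_vec_in_SL SL_segment by blast
qed

end
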